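(* The monoid $\mathbb{L}$ of lex-minimal extensions is an inductive limit of the increasing system $(\langle L_k(\mathbb{I}_k)\rangle)_{k\in\mathbb{N}}$ of finitely presented monoids. Moreover, $(\mathbf{Atom}\cap L_k(\mathbb{I}_k))_{k\in\mathbb{N}}$ is an increasing system of generators of $(\langle L_k(\mathbb{I}_k)\rangle)_{k\in\mathbb{N}}$ (that is, these sets increase with $k$ and $\mathbf{Atom}\cap L_k(\mathbb{I}_k)$ generates $\langle L_k(\mathbb{I}_k)\rangle$ for each $k$).
   Context: $\mathbb{N}=\{1,2,3,\dots\}$. A sequence $(e_i)_{i\le m}$ of nonnegative integers, where $m\in\mathbb{N}$ (finite sequence of length $m$) or $m=\infty$ (infinite sequence indexed by $\mathbb{N}$), is a binomid index if $\sum_{i=n-k+1}^{n}e_i\ge\sum_{i=1}^k e_i$ for all $k,n\in\mathbb{N}$ with $1\le k\le n\le m$. $\mathbb{I}$ is the set of all infinite binomid indices, and $\mathbb{I}_k$ the set of all finite binomid indices of length $k$. Every finite binomid index $\eta$ extends to an infinite binomid index having $\eta$ as its initial segment; among all such extensions there is a unique lexicographically minimal one, denoted $\tilde\eta$ and called the lex-minimal extension of $\eta$. $\mathbb{L}\subseteq\mathbb{I}$ is the set of all lex-minimal extensions of finite binomid indices; it is known to be a commutative monoid under componentwise addition. The map $L_k:\mathbb{I}_k\to\mathbb{L}$ is $L_k(\eta)=\tilde\eta$. For a subset $A$ of a monoid $M$ with identity $0$, $\langle A\rangle=\{\mu_1+\dots+\mu_n\mid \mu_i\in A,\ n\in\mathbb{N}\}\cup\{0\}$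 is the submonoid generated by $A$; here $\langle L_k(\mathbb{I}_k)\rangle$ is taken in $\mathbb{L}$. An infinite binomid index $\eta$ is atomic if there are no nonzero (infinite) binomid indices $\eta_1,\eta_2$ with $\eta=\eta_1+\eta_2$; $\mathbf{Atom}$ is the set of all nonzero atomic infinite binomid indices. The maps in the increasing system are the inclusions. *)

theory Defs
  imports
    Main
    "HOL-Library.Extended_Nat"
    "HOL-Library.Function_Algebras"
    "HOL-Library.Fun_Lexorder"
    "HOL-Algebra.Group"
begin

section \<open>Binomid indices\<close>

text \<open>Indices are shifted by one: the value \<open>e i\<close> is the entry with number \<open>i + 1\<close> of the
  sequence. Only the entries below the length \<open>m\<close> matter here.\<close>

definition binomid_index :: "enat \<Rightarrow> (nat \<Rightarrow> nat) \<Rightarrow> bool" where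
  "binomid_index m e \<longleftrightarrow>
     (\<forall>k n. 1 \<le> k \<and> k \<le> n \<and> enat n \<le> m \<longrightarrow> (\<Sum>i=n-k..<n. e i) \<ge> (\<Sum>i<k. e i))"

definition inf_binomid :: "(nat \<Rightarrow> nat) set" where
  "inf_binomid = {e. binomid_index \<infinity> e}"

definition fin_binomid :: "nat \<Rightarrow> nat list set" where
  "fin_binomid k = {\<eta>. length \<eta> = k \<and> binomid_index (enat k) (\<lambda>i. \<eta> ! i)}"

definition extensions :: "nat list \<Rightarrow> (nat \<Rightarrow> nat) set" where
  "extensions \<eta> = {e \<in> inf_binomid. \<forall>i < length \<eta>. e i = \<eta> ! i}"

text \<open>The order \<^const>\<open>less_fun\<close> is the strict lexicographic order on functions.\<close>

definition lex_min_ext :: "nat list \<Rightarrow> (nat \<Rightarrow> nat)" where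
  "lex_min_ext \<eta> =
     (THE e. e \<in> extensions \<eta> \<and> (\<forall>f \<in> extensions \<eta>. f \<noteq> e \<longrightarrow> less_fun e f))"

definition L_image :: "nat \<Rightarrow> (nat \<Rightarrow> nat) set" where
  "L_image k = lex_min_ext ` fin_binomid k"

definition lex_min_seqs :: "(nat \<Rightarrow> nat) set" where
  "lex_min_seqs = {lex_min_ext \<eta> | \<eta> k. 1 \<le> k \<and> \<eta> \<in> fin_binomid k}"

definition Atom :: "(nat \<Rightarrow> nat) set" where
  "Atom = {\<eta> \<in> inf_binomid. \<eta> \<noteq> 0 \<and>
     \<not> (\<exists>\<eta>1 \<eta>2. \<eta>1 \<in> inf_binomid \<and> \<eta>2 \<in> inf_binomid \<and> \<eta>1 \<noteq> 0 \<and> \<eta>2 \<noteq> 0 \<and> \<eta> = \<eta>1 + \<eta>2)}"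


section \<open>Monoids\<close>

definition gen_submonoid :: "'a::monoid_add set \<Rightarrow> 'a set" where
  "gen_submonoid A = {sum_list xs | xs. xs \<noteq> [] \<and> set xs \<subseteq> A} \<union> {0}"

definition additive_monoid :: "'a::monoid_add set \<Rightarrow> 'a monoid" where
  "additive_monoid S = \<lparr>carrier = S, monoid.mult = (+), one = 0\<rparr>"

text \<open>The set \<^const>\<open>hom\<close> does not require that the unit is preserved.\<close>

definition monoid_hom :: "('a, 'm) monoid_scheme \<Rightarrow> ('b, 'n) monoid_scheme \<Rightarrow> ('a \<Rightarrow> 'b) set" where
  "monoid_hom G H = {h \<in> hom G H. h \<one>\<^bsub>G\<^esub> = \<one>\<^bsub>H\<^esub>}"


subsection \<open>Finite presentations\<close>

text \<open>The congruence on the free monoid \<open>lists A\<close> generated by the relations \<open>R\<close>.\<close>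

inductive_set pres_cong :: "'a set \<Rightarrow> ('a list \<times> 'a list) set \<Rightarrow> ('a list \<times> 'a list) set"
  for A :: "'a set" and R :: "('a list \<times> 'a list) set" where
  rel: "(u, v) \<in> R \<Longrightarrow> u \<in> lists A \<Longrightarrow> v \<in> lists A \<Longrightarrow> (u, v) \<in> pres_cong A R"
| refl: "u \<in> lists A \<Longrightarrow> (u, u) \<in> pres_cong A R"
| sym: "(u, v) \<in> pres_cong A R \<Longrightarrow> (v, u) \<in> pres_cong A R"
| trans: "(u, v) \<in> pres_cong A R \<Longrightarrow> (v, w) \<in> pres_cong A R \<Longrightarrow> (u, w) \<in> pres_cong A R"
| append: "(u, v) \<in> pres_cong A R \<Longrightarrow> (u', v') \<in> pres_cong A R \<Longrightarrow>
    (u @ u', v @ v') \<in> pres_cong A R"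

definition presented_monoid :: "'a set \<Rightarrow> ('a list \<times> 'a list) set \<Rightarrow> 'a list set monoid" where
  "presented_monoid A R =
     \<lparr>carrier = lists A // pres_cong A R,
      monoid.mult = (\<lambda>X Y. pres_cong A R `` {u @ v | u v. u \<in> X \<and> v \<in> Y}),
      one = pres_cong A R `` {[]}\<rparr>"

text \<open>A finite alphabet can always be taken to consist of natural numbers.\<close>

definition finitely_presented_monoid :: "('a, 'm) monoid_scheme \<Rightarrow> bool" where
  "finitely_presented_monoid M \<longleftrightarrow> monoid M \<and>
     (\<exists>(A :: nat set) R. finite A \<and> finite R \<and> R \<subseteq> lists A \<times> lists A \<and>
        presented_monoid A R \<cong> M)"


subsection \<open>Inductive limits\<close>

definition directed_system ::
  "'i::order set \<Rightarrow> ('i \<Rightarrow> ('a, 'm) monoid_scheme) \<Rightarrow> ('i \<Rightarrow> 'i \<Rightarrow> 'a \<Rightarrow> 'a) \<Rightarrow> bool" where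
  "directed_system I M \<phi> \<longleftrightarrow>
     I \<noteq> {} \<and> (\<forall>i\<in>I. \<forall>j\<in>I. \<exists>k\<in>I. i \<le> k \<and> j \<le> k) \<and>
     (\<forall>i\<in>I. monoid (M i)) \<and>
     (\<forall>i\<in>I. \<forall>j\<in>I. i \<le> j \<longrightarrow> \<phi> i j \<in> monoid_hom (M i) (M j)) \<and>
     (\<forall>i\<in>I. \<forall>x\<in>carrier (M i). \<phi> i i x = x) \<and>
     (\<forall>i\<in>I. \<forall>j\<in>I. \<forall>k\<in>I. i \<le> j \<and> j \<le> k \<longrightarrow>
        (\<forall>x\<in>carrier (M i). \<phi> j k (\<phi> i j x) = \<phi> i k x))"

definition cocone ::
  "'i::order set \<Rightarrow> ('i \<Rightarrow> ('a, 'm) monoid_scheme) \<Rightarrow> ('i \<Rightarrow> 'i \<Rightarrow> 'a \<Rightarrow> 'a) \<Rightarrow>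
   ('b, 'n) monoid_scheme \<Rightarrow> ('i \<Rightarrow> 'a \<Rightarrow> 'b) \<Rightarrow> bool" where
  "cocone I M \<phi> N f \<longleftrightarrow>
     monoid N \<and> (\<forall>i\<in>I. f i \<in> monoid_hom (M i) N) \<and>
     (\<forall>i\<in>I. \<forall>j\<in>I. i \<le> j \<longrightarrow> (\<forall>x\<in>carrier (M i). f j (\<phi> i j x) = f i x))"

text \<open>The universal property in the category of monoids. A definition cannot quantify over types,
  so the carrier type \<open>'c\<close> of the test monoids is a parameter; a theorem in which \<open>'c\<close> is a free
  type variable states the property for test monoids over every type. Homomorphisms are only
  determined on the carrier.\<close>

definition is_inductive_limit ::
  "'c itself \<Rightarrow> 'i::order set \<Rightarrow> ('i \<Rightarrow> ('a, 'm) monoid_scheme) \<Rightarrow> ('i \<Rightarrow> 'i \<Rightarrow> 'a \<Rightarrow> 'a) \<Rightarrow>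
   ('b, 'n) monoid_scheme \<Rightarrow> ('i \<Rightarrow> 'a \<Rightarrow> 'b) \<Rightarrow> bool" where
  "is_inductive_limit T I M \<phi> L \<psi> \<longleftrightarrow>
     directed_system I M \<phi> \<and> cocone I M \<phi> L \<psi> \<and>
     (\<forall>(N :: 'c monoid) f. cocone I M \<phi> N f \<longrightarrow>
        (\<exists>h \<in> monoid_hom L N.
           (\<forall>i\<in>I. \<forall>x\<in>carrier (M i). h (\<psi> i x) = f i x) \<and>
           (\<forall>h' \<in> monoid_hom L N.
              (\<forall>i\<in>I. \<forall>x\<in>carrier (M i). h' (\<psi> i x) = f i x) \<longrightarrow>
              (\<forall>y\<in>carrier L. h' y = h y))))"

end

theory Submission
  imports Defs "HOL-Library.Infinite_Set" "HOL-Library.Multiset"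
begin

text \<open>The partial sums of a binomid index are superadditive, and the lex-minimal extensions of
  indices of length \<open>k\<close> are those for which every partial sum beyond \<open>k\<close> splits as a sum of two
  smaller ones. Such a splitting is inherited by both summands of a decomposition, so the
  atomic ones generate. If \<open>p \<le> k\<close> maximises the ratio of the \<open>p\<close>-th partial sum to \<open>p\<close>, then
  \<open>psum e (n + p) = psum e n + psum e p\<close> for \<open>n \<ge> k * k\<close>. Passing to the common period \<open>k!\<close> gives a
  condition that is additive and depends only on \<open>k\<close>: hence sums of lex-minimal extensions are
  lex-minimal, and whether one index may be subtracted from another is decided by finitely many
  numbers. Dickson's lemma then bounds the number of atoms. A finitely generated cancellative
  commutative monoid is finitely presented, again by Dickson's lemma.\<close>

section \<open>Dickson's lemma\<close>

text \<open>An index that minimises \<open>s\<close> over all indices from \<open>n\<close> on lies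
  in \<open>?M\<close>, so \<open>?M\<close> is infinite; along its increasing enumeration
  \<open>s\<close> cannot decrease.\<close>

lemma mono_subsequence_nat:
  fixes s :: "nat \<Rightarrow> nat"
  obtains r :: "nat \<Rightarrow> nat" where "strict_mono r" "mono (\<lambda>n. s (r n))"
proof -
  let ?M = "{m. \<forall>m'\<ge>m. s m \<le> s m'}"
  have "\<exists>m\<ge>n. m \<in> ?M" for n
  proof -
    obtain m where "m \<ge> n" "\<forall>y\<ge>n. s m \<le> s y"
      using ex_has_least_nat[of "\<lambda>m. m \<ge> n" n s] by auto
    then show ?thesis by (intro exI[of _ m]) auto
  qed
  then have "infinite ?M"
    unfolding infinite_nat_iff_unbounded_le by blast
  from infinite_enumerate[OF this]
  obtain r :: "nat \<Rightarrow> nat" where r: "strict_mono r" "\<forall>n. r n \<in> ?M"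
    by (elim exE conjE)
  have "mono (\<lambda>n. s (r n))"
    using r by (auto simp: mono_def strict_mono_less_eq)
  with r(1) show ?thesis by (rule that)
qed

text \<open>Coordinates are added one at a time: thinning the sequence to make a new coordinate
  monotone keeps the earlier ones monotone. Injectivity of \<open>g\<close> later makes the two
  compared elements distinct.\<close>

lemma dickson_sequence:
  fixes v :: "'x \<Rightarrow> 'i \<Rightarrow> nat"
  assumes "infinite X" and "finite I"
  shows "\<exists>g::nat \<Rightarrow> 'x. inj g \<and> range g \<subseteq> X \<and> (\<forall>i\<in>I. mono (\<lambda>n. v (g n) i))"
  using assms(2)
proof (induction I rule: finite_induct)
  case empty
  then show ?case using infinite_countable_subset[OF assms(1)] by auto
next
  case (insert i I)
  then obtain g :: "nat \<Rightarrow> 'x" where g: "inj g" "range g \<subseteq> X" "\<forall>i\<in>I. mono (\<lambda>n. v (g n) i)"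
    by blast
  obtain r :: "nat \<Rightarrow> nat" where r: "strict_mono r" "mono (\<lambda>n. v (g (r n)) i)"
    by (rule mono_subsequence_nat)
  have "inj (g \<circ> r)"
    using g(1) strict_mono_imp_inj_on[OF r(1)] by (rule inj_compose)
  moreover have "range (g \<circ> r) \<subseteq> X" using g(2) by auto
  moreover have "\<forall>i'\<in>insert i I. mono (\<lambda>n. v ((g \<circ> r) n) i')"
    using g(3) r by (auto simp: mono_def strict_mono_less_eq)
  ultimately show ?case by blast
qed

lemma dickson:
  fixes v :: "'x \<Rightarrow> 'i \<Rightarrow> nat"
  assumes "infinite X" and "finite I"
  obtains x y where "x \<in> X" "y \<in> X" "x \<noteq> y" "\<forall>i\<in>I. v x i \<le> v y i"
proof -
  obtain g :: "nat \<Rightarrow> 'x" where g: "inj g" "range g \<subseteq> X" "\<forall>i\<in>I. mono (\<lambda>n. v (g n) i)"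
    using dickson_sequence[OF assms] by blast
  show ?thesis
  proof (rule that[of "g 0" "g 1"])
    show "g 0 \<noteq> g 1" using g(1) by (auto simp: inj_eq)
  qed (use g in \<open>auto simp: mono_def\<close>)
qed


section \<open>Finitely generated cancellative commutative monoids\<close>

lemma gen_submonoid_iff:
  "x \<in> gen_submonoid A \<longleftrightarrow> (\<exists>xs. set xs \<subseteq> A \<and> x = sum_list xs)"
proof
  assume "x \<in> gen_submonoid A"
  then show "\<exists>xs. set xs \<subseteq> A \<and> x = sum_list xs"
    unfolding gen_submonoid_def by (auto intro: exI[of _ "[]"])
next
  assume "\<exists>xs. set xs \<subseteq> A \<and> x = sum_list xs"
  then obtain xs where "set xs \<subseteq> A" "x = sum_list xs" by blast
  then show "x \<in> gen_submonoid A"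
    unfolding gen_submonoid_def by (cases xs) fastforce+
qed

lemma zero_in_gen_submonoid [simp]: "0 \<in> gen_submonoid A"
  by (simp add: gen_submonoid_def)

lemma gen_submonoid_superset: "A \<subseteq> gen_submonoid A"
proof
  fix x assume "x \<in> A"
  then show "x \<in> gen_submonoid A"
    unfolding gen_submonoid_iff by (intro exI[of _ "[x]"]) auto
qed

lemma gen_submonoid_add:
  "x \<in> gen_submonoid A \<Longrightarrow> y \<in> gen_submonoid A \<Longrightarrow> x + y \<in> gen_submonoid A"
  unfolding gen_submonoid_iff
proof (elim exE conjE)
  fix xs ys assume "set xs \<subseteq> A" "x = sum_list xs" "set ys \<subseteq> A" "y = sum_list ys"
  then show "\<exists>zs. set zs \<subseteq> A \<and> x + y = sum_list zs"
    by (intro exI[of _ "xs @ ys"]) auto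
qed

lemma gen_submonoid_least:
  assumes "A \<subseteq> S" "0 \<in> S" "\<And>x y. x \<in> S \<Longrightarrow> y \<in> S \<Longrightarrow> x + y \<in> S"
  shows "gen_submonoid A \<subseteq> S"
proof -
  have "set xs \<subseteq> A \<Longrightarrow> sum_list xs \<in> S" for xs
    by (induction xs) (use assms in auto)
  then show ?thesis by (auto simp: gen_submonoid_iff)
qed

lemma monoid_additive_monoid:
  fixes S :: "'a::monoid_add set"
  assumes "0 \<in> S" "\<And>x y. x \<in> S \<Longrightarrow> y \<in> S \<Longrightarrow> x + y \<in> S"
  shows "monoid (additive_monoid S)"
  by (rule monoidI) (use assms in \<open>auto simp: additive_monoid_def add.assoc\<close>)

section \<open>Words, their congruences and presentations\<close>

lemma pres_cong_lists: "(u, v) \<in> pres_cong A R \<Longrightarrow> u \<in> lists A \<and> v \<in> lists A"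
  by (induction rule: pres_cong.induct) auto

lemma equiv_pres_cong: "equiv (lists A) (pres_cong A R)"
proof (rule equivI)
  show "pres_cong A R \<subseteq> lists A \<times> lists A" using pres_cong_lists by fastforce
qed (auto intro!: refl_onI symI transI intro: pres_cong.intros)

lemma pres_cong_append_left:
  "w \<in> lists A \<Longrightarrow> (u, v) \<in> pres_cong A R \<Longrightarrow> (w @ u, w @ v) \<in> pres_cong A R"
  by (rule pres_cong.append[OF pres_cong.refl])

lemma pres_cong_append_right:
  "w \<in> lists A \<Longrightarrow> (u, v) \<in> pres_cong A R \<Longrightarrow> (u @ w, v @ w) \<in> pres_cong A R"
  by (rule pres_cong.append[OF _ pres_cong.refl])

text \<open>The isomorphism theorem for evaluation of words. It reduces a finite presentation to
  finding finitely many relations that generate the kernel of evaluation.\<close>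

lemma presented_monoid_iso:
  fixes g :: "'b \<Rightarrow> 'a::monoid_add"
  defines "ev \<equiv> \<lambda>w. sum_list (map g w)"
  assumes ker: "\<And>u v. u \<in> lists A \<Longrightarrow> v \<in> lists A \<Longrightarrow> (u, v) \<in> pres_cong A R \<longleftrightarrow> ev u = ev v"
  shows "presented_monoid A R \<cong> additive_monoid (gen_submonoid (g ` A))"
proof -
  let ?C = "pres_cong A R"
  let ?P = "presented_monoid A R"
  let ?M = "additive_monoid (gen_submonoid (g ` A))"
  \<comment> \<open>The chosen representative does not matter: by \<open>mem\<close> below, each
    class is a level set of \<open>ev\<close> on \<open>lists A\<close>.\<close>
  define h where "h = (\<lambda>X. ev (SOME u. u \<in> X))"
  have mem: "u \<in> ?C `` {w} \<longleftrightarrow> u \<in> lists A \<and> ev u = ev w" if "w \<in> lists A" for u w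
    using ker[OF that, of u] pres_cong_lists[of w u A R] unfolding Image_singleton_iff by metis
  have h: "h (?C `` {w}) = ev w" if "w \<in> lists A" for w
  proof -
    have "w \<in> ?C `` {w}" using pres_cong.refl[OF that] by (rule ImageI) simp
    then have "(SOME u. u \<in> ?C `` {w}) \<in> ?C `` {w}" by (rule someI)
    then show ?thesis unfolding h_def mem[OF that] by (rule conjunct2)
  qed
  have carrier: "carrier ?P = (\<lambda>w. ?C `` {w}) ` lists A"
    by (auto simp: presented_monoid_def quotient_def)
  have ev_append: "ev (u @ v) = ev u + ev v" for u v by (simp add: ev_def)
  have mult: "?C `` {u} \<otimes>\<^bsub>?P\<^esub> ?C `` {v} = ?C `` {u @ v}"
    if uv: "u \<in> lists A" "v \<in> lists A" for u v
  proof -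
    have "?C `` {x @ y | x y. x \<in> ?C `` {u} \<and> y \<in> ?C `` {v}} = ?C `` {u @ v}" (is "?L = ?R")
    proof
      show "?L \<subseteq> ?R"
      proof
        fix z assume "z \<in> ?L"
        then obtain x y where "(x @ y, z) \<in> ?C" "(u, x) \<in> ?C" "(v, y) \<in> ?C" by blast
        then have "(u @ v, z) \<in> ?C" by (meson pres_cong.append pres_cong.trans)
        then show "z \<in> ?R" by blast
      qed
      show "?R \<subseteq> ?L"
        using pres_cong.refl[OF uv(1)] pres_cong.refl[OF uv(2)] by blast
    qed
    then show ?thesis by (simp add: presented_monoid_def)
  qed
  have range: "ev ` lists A = gen_submonoid (g ` A)"
  proof
    show "ev ` lists A \<subseteq> gen_submonoid (g ` A)"
    proof (rule image_subsetI)
      fix w assume "w \<in> lists A"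
      then have "set (map g w) \<subseteq> g ` A" by auto
      then show "ev w \<in> gen_submonoid (g ` A)"
        unfolding gen_submonoid_iff ev_def by blast
    qed
    show "gen_submonoid (g ` A) \<subseteq> ev ` lists A"
    proof
      fix x assume "x \<in> gen_submonoid (g ` A)"
      then obtain xs where xs: "set xs \<subseteq> g ` A" "x = sum_list xs"
        by (auto simp: gen_submonoid_iff)
      then have "xs \<in> lists (g ` A)" by auto
      then obtain w where "w \<in> lists A" "xs = map g w"
        by (auto simp: lists_image)
      then show "x \<in> ev ` lists A" using xs by (auto simp: ev_def)
    qed
  qed
  have "h \<in> iso ?P ?M"
    unfolding iso_iff
  proof (intro conjI)
    show "h ` carrier ?P = carrier ?M"
      unfolding carrier image_image using h range by (simp add: additive_monoid_def)
    show "inj_on h (carrier ?P)"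
      unfolding carrier
    proof (rule inj_onI, elim imageE)
      fix X Y u v
      assume *: "h X = h Y" "X = ?C `` {u}" "u \<in> lists A" "Y = ?C `` {v}" "v \<in> lists A"
      then have "(u, v) \<in> ?C" using h ker by metis
      then show "X = Y" using * equiv_class_eq[OF equiv_pres_cong] by metis
    qed
    show "h \<in> hom ?P ?M"
    proof (rule homI)
      fix X assume "X \<in> carrier ?P"
      then show "h X \<in> carrier ?M"
        using h range by (auto simp: carrier additive_monoid_def)
    next
      fix X Y assume "X \<in> carrier ?P" "Y \<in> carrier ?P"
      then obtain u v where uv: "u \<in> lists A" "X = ?C `` {u}" "v \<in> lists A" "Y = ?C `` {v}"
        by (auto simp: carrier)
      then have "u @ v \<in> lists A" by auto
      then show "h (X \<otimes>\<^bsub>?P\<^esub> Y) = h X \<otimes>\<^bsub>?M\<^esub> h Y"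
        using uv by (simp add: mult h ev_append additive_monoid_def)
    qed
  qed
  then show ?thesis by (rule is_isoI)
qed

text \<open>The first letter \<open>a\<close> of \<open>u\<close> occurs in \<open>v\<close>; the
  commutations carry it from the front to that place letter by letter, and the remaining letters
  follow by induction.\<close>

lemma pres_cong_mset_eq:
  assumes comm: "\<And>a b. a \<in> A \<Longrightarrow> b \<in> A \<Longrightarrow> ([a, b], [b, a]) \<in> R"
    and "u \<in> lists A" "mset u = mset v"
  shows "(u, v) \<in> pres_cong A R"
  using assms(2,3)
proof (induction u arbitrary: v rule: list.induct)
  case Nil
  then show ?case by (simp add: pres_cong.refl)
next
  case (Cons a u)
  then have "a \<in> set v" by (metis list.set_intros(1) set_mset_mset)
  then obtain v1 v2 where v: "v = v1 @ a # v2" by (meson split_list)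
  have a: "a \<in> A" and u: "u \<in> lists A" using Cons.prems(1) by simp_all
  have "set v = set (a # u)" using Cons.prems(2) by (metis set_mset_mset)
  then have v12: "v1 \<in> lists A" "v2 \<in> lists A" using a u v by auto
  have "([a] @ v1, v1 @ [a]) \<in> pres_cong A R"
    using v12(1)
  proof (induction v1)
    case Nil
    then show ?case using a by (simp add: pres_cong.refl)
  next
    case (Cons b v1)
    then have b: "b \<in> A" "v1 \<in> lists A" by auto
    have "([a, b] @ v1, [b, a] @ v1) \<in> pres_cong A R"
      using a b comm by (intro pres_cong_append_right pres_cong.rel) auto
    moreover have "([b] @ ([a] @ v1), [b] @ (v1 @ [a])) \<in> pres_cong A R"
      using b Cons.IH by (intro pres_cong_append_left) auto
    ultimately show ?case by (auto intro: pres_cong.trans)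
  qed
  then have "(([a] @ v1) @ v2, (v1 @ [a]) @ v2) \<in> pres_cong A R"
    using v12 by (intro pres_cong_append_right) auto
  moreover have "(u, v1 @ v2) \<in> pres_cong A R"
    using Cons.prems(2) v u by (intro Cons.IH) auto
  then have "([a] @ u, [a] @ (v1 @ v2)) \<in> pres_cong A R"
    using a by (intro pres_cong_append_left) auto
  ultimately show ?case using v by (auto intro: pres_cong.trans)
qed

text \<open>By Dickson's lemma an infinite set of minimal pairs would contain two distinct
  comparable ones, against minimality of the larger.\<close>

lemma finite_minimal_mset_pairs:
  fixes K :: "('b multiset \<times> 'b multiset) set"
  assumes "finite A" and K: "\<And>x y. (x, y) \<in> K \<Longrightarrow> set_mset x \<subseteq> A \<and> set_mset y \<subseteq> A"
  shows "finite {(x, y) \<in> K. \<forall>(x', y') \<in> K. x' \<subseteq># x \<and> y' \<subseteq># y \<longrightarrow> (x', y') = (x, y)}" (is "finite ?B")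
proof (rule ccontr)
  assume inf: "infinite ?B"
  \<comment> \<open>A pair becomes one vector over \<open>A <+> A\<close>: \<open>Inl\<close> reads
    multiplicities in the first component, \<open>Inr\<close> in the second.\<close>
  define v where "v = (\<lambda>(x :: 'b multiset, y :: 'b multiset) s.
    case s of Inl a \<Rightarrow> count x a | Inr a \<Rightarrow> count y a)"
  have "finite (A <+> A)" using assms(1) by simp
  with inf obtain p q where
    pq: "p \<in> ?B" "q \<in> ?B" "p \<noteq> q" "\<forall>i\<in>A <+> A. v p i \<le> v q i"
    by (rule dickson)
  obtain x y x' y' where p: "p = (x, y)" and q: "q = (x', y')" by (cases p, cases q) blast
  have "count x a \<le> count x' a" for a
  proof (cases "a \<in> A")
    case True
    then show ?thesis using bspec[OF pq(4), of "Inl a"] by (auto simp: v_def p q)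
  next
    case False
    then have "a \<notin># x" using K pq(1) p by auto
    then show ?thesis by (simp add: not_in_iff)
  qed
  then have x: "x \<subseteq># x'" by (simp add: subseteq_mset_def)
  have "count y a \<le> count y' a" for a
  proof (cases "a \<in> A")
    case True
    then show ?thesis using bspec[OF pq(4), of "Inr a"] by (auto simp: v_def p q)
  next
    case False
    then have "a \<notin># y" using K pq(1) p by auto
    then show ?thesis by (simp add: not_in_iff)
  qed
  then have "y \<subseteq># y'" by (simp add: subseteq_mset_def)
  then show False using x pq(1-3) by (auto simp: p q)
qed

text \<open>Descent: a pair that is not minimal lies above one of smaller total size.\<close>

lemma exists_minimal_mset_pair:
  fixes K :: "('b multiset \<times> 'b multiset) set"
  assumes "(x, y) \<in> K"
  shows "\<exists>x0 y0. (x0, y0) \<in> K \<and> x0 \<subseteq># x \<and> y0 \<subseteq># y \<and>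
    (\<forall>(x', y') \<in> K. x' \<subseteq># x0 \<and> y' \<subseteq># y0 \<longrightarrow> (x', y') = (x0, y0))"
  using assms
proof (induction "size x + size y" arbitrary: x y rule: less_induct)
  case less
  show ?case
  proof (cases "\<forall>(x', y') \<in> K. x' \<subseteq># x \<and> y' \<subseteq># y \<longrightarrow> (x', y') = (x, y)")
    case True
    then show ?thesis using less.prems by blast
  next
    case False
    then obtain x' y' where *: "(x', y') \<in> K" "x' \<subseteq># x" "y' \<subseteq># y" "(x', y') \<noteq> (x, y)" by blast
    then have "x' \<subset># x \<or> y' \<subset># y" by (auto simp: subset_mset_def)
    then have "size x' + size y' < size x + size y"
      using *(2,3) by (metis add_le_less_mono add_less_le_mono mset_subset_size size_mset_mono)
    from less.hyps[OF this *(1)] show ?thesis using *(2,3) by (meson subset_mset.order_trans)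
  qed
qed

text \<open>Cancellation makes the kernel of the evaluation of words closed under differences, so that
  its minimal nonzero elements, finite in number by Dickson's lemma, generate it. This is the easy
  case of Redei's theorem.\<close>

lemma finitely_presented_gen_submonoid:
  fixes B :: "'a::cancel_comm_monoid_add set"
  assumes "finite B"
  shows "finitely_presented_monoid (additive_monoid (gen_submonoid B))"
proof -
  \<comment> \<open>The generators are numbered because \<open>finitely_presented_monoid\<close>
    asks for an alphabet of natural numbers.\<close>
  obtain n :: nat and g :: "nat \<Rightarrow> 'a" where B: "B = g ` {i. i < n}"
    using assms by (metis finite_imp_nat_seg_image_inj_on)
  define A where "A = {i. i < n}"
  have finA: "finite A" by (simp add: A_def)
  define ev where "ev = (\<lambda>w. sum_list (map g w))"
  \<comment> \<open>The kernel of evaluation on multisets. The pair of empty multisets is left out,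
    since it lies below every pair and would be the only minimal one.\<close>
  define K where "K = {(x, y). set_mset x \<subseteq> A \<and> set_mset y \<subseteq> A \<and>
    (x, y) \<noteq> ({#}, {#}) \<and> (\<Sum>i\<in>#x. g i) = (\<Sum>i\<in>#y. g i)}"
  define Min where "Min = {(x, y) \<in> K. \<forall>(x', y') \<in> K. x' \<subseteq># x \<and> y' \<subseteq># y \<longrightarrow> (x', y') = (x, y)}"
  have finMin: "finite Min"
    unfolding Min_def by (rule finite_minimal_mset_pairs[OF finA]) (auto simp: K_def)
  define W where "W = (\<lambda>x :: nat multiset. sorted_list_of_multiset x)"
  \<comment> \<open>The commutations reduce words to multisets; the minimal pairs, written as sorted
    words, then account for the kernel.\<close>
  define R where "R = (\<lambda>(a, b). ([a, b], [b, a])) ` (A \<times> A) \<union> (\<lambda>(x, y). (W x, W y)) ` Min"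
  have finR: "finite R" using finA finMin by (simp add: R_def)
  have mset_W [simp]: "mset (W x) = x" for x by (simp add: W_def)
  then have set_W [simp]: "set (W x) = set_mset x" for x by (metis set_mset_mset)
  have ev_mset: "ev w = (\<Sum>i\<in>#mset w. g i)" for w
    by (simp add: ev_def flip: sum_mset_sum_list)
  have RA: "R \<subseteq> lists A \<times> lists A"
    by (auto simp: R_def Min_def K_def)
  have R_ev: "ev u = ev v" if "(u, v) \<in> R" for u v
    using that by (auto simp: R_def Min_def K_def ev_mset add.commute)
  have sound: "(u, v) \<in> pres_cong A R \<Longrightarrow> ev u = ev v" for u v
    by (induction rule: pres_cong.induct) (auto simp: R_ev, auto simp: ev_def)
  have perm: "(u, v) \<in> pres_cong A R" if "u \<in> lists A" "mset u = mset v" for u v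
    by (rule pres_cong_mset_eq[OF _ that]) (auto simp: R_def)
  have complete: "(u, v) \<in> pres_cong A R" if "u \<in> lists A" "v \<in> lists A" "ev u = ev v" for u v
    using that
  proof (induction "length u + length v" arbitrary: u v rule: less_induct)
    case less
    show ?case
    proof (cases "u = [] \<and> v = []")
      case True
      then show ?thesis by (simp add: pres_cong.refl)
    next
      case False
      then have "(mset u, mset v) \<in> K"
        using less.prems by (auto simp: K_def ev_mset)
      then obtain x y where xy: "(x, y) \<in> Min" "x \<subseteq># mset u" "y \<subseteq># mset v"
        using exists_minimal_mset_pair[of "mset u" "mset v" K] unfolding Min_def by blast
      define u' where "u' = W (mset u - x)"
      define v' where "v' = W (mset v - y)"
      have K: "(x, y) \<in> K" using xy(1) by (simp add: Min_def)
      have mu: "mset u = mset (W x @ u')" and mv: "mset v = mset (W y @ v')"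
        using xy by (simp_all add: u'_def v'_def)
      have "set u' \<subseteq> set u" "set v' \<subseteq> set v"
        by (auto simp: u'_def v'_def dest: in_diffD)
      then have lists: "u' \<in> lists A" "v' \<in> lists A" using less.prems by auto
      have "ev (W x) = ev (W y)" using K by (simp add: K_def ev_mset)
      moreover have "ev (W x) + ev u' = ev (W y) + ev v'"
        using less.prems(3) mu mv unfolding ev_mset by simp
      \<comment> \<open>Cancellation enters here: after a minimal pair is removed, the remainders
        still have equal values, and they are shorter in total because the pair is not
        empty.\<close>
      ultimately have ev: "ev u' = ev v'" by simp
      have "size x + size y \<noteq> 0" using K by (auto simp: K_def)
      moreover have "length u = size x + length u'" "length v = size y + length v'"
        using arg_cong[OF mu, of size] arg_cong[OF mv, of size] arg_cong[OF mset_W, of size]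
        by (simp_all flip: size_mset)
      ultimately have "length u' + length v' < length u + length v" by linarith
      from less.hyps[OF this lists ev] have "(u', v') \<in> pres_cong A R" .
      moreover have "(W x, W y) \<in> pres_cong A R"
        using xy(1) K by (intro pres_cong.rel) (auto simp: R_def K_def)
      ultimately have "(W x @ u', W y @ v') \<in> pres_cong A R" by (intro pres_cong.append)
      moreover have "(u, W x @ u') \<in> pres_cong A R" "(v, W y @ v') \<in> pres_cong A R"
        using perm less.prems mu mv by auto
      ultimately show ?thesis by (meson pres_cong.sym pres_cong.trans)
    qed
  qed
  have "presented_monoid A R \<cong> additive_monoid (gen_submonoid (g ` A))"
  proof (rule presented_monoid_iso)
    fix u v assume "u \<in> lists A" "v \<in> lists A"
    then show "(u, v) \<in> pres_cong A R \<longleftrightarrow> sum_list (map g u) = sum_list (map g v)"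
      using sound[of u v] complete[of u v] unfolding ev_def by blast
  qed
  then have "presented_monoid A R \<cong> additive_monoid (gen_submonoid B)"
    unfolding B A_def .
  moreover have "monoid (additive_monoid (gen_submonoid B))"
    by (intro monoid_additive_monoid zero_in_gen_submonoid gen_submonoid_add)
  ultimately show ?thesis
    unfolding finitely_presented_monoid_def using finA finR RA by blast
qed


section \<open>Unions of chains of submonoids\<close>

text \<open>Any two elements of the union lie in a common \<open>G k\<close>, so compatible
  homomorphisms glue, and their values on the stages determine the result.\<close>

lemma inductive_limit_chain_union:
  fixes G :: "nat \<Rightarrow> 'a::monoid_add set"
  assumes zero: "\<And>k. k \<ge> 1 \<Longrightarrow> 0 \<in> G k"
    and add: "\<And>k x y. k \<ge> 1 \<Longrightarrow> x \<in> G k \<Longrightarrow> y \<in> G k \<Longrightarrow> x + y \<in> G k"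
    and chain: "\<And>k l. 1 \<le> k \<Longrightarrow> k \<le> l \<Longrightarrow> G k \<subseteq> G l"
    and U: "U = (\<Union>k\<in>{1..}. G k)"
  shows "is_inductive_limit TYPE('c) {1::nat..} (\<lambda>k. additive_monoid (G k)) (\<lambda>k l x. x)
    (additive_monoid U) (\<lambda>k x. x)"
proof -
  have common: "\<exists>k\<ge>1. x \<in> G k \<and> y \<in> G k" if xy: "x \<in> U" "y \<in> U" for x y
  proof -
    obtain i j where "i \<ge> 1" "x \<in> G i" "j \<ge> 1" "y \<in> G j" using xy by (auto simp: U)
    then show ?thesis
      using chain[of i "max i j"] chain[of j "max i j"] by (intro exI[of _ "max i j"]) auto
  qed
  have UI: "x \<in> U" if "k \<ge> 1" "x \<in> G k" for k x
    using that by (auto simp: U)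
  have addU: "x + y \<in> U" if "x \<in> U" "y \<in> U" for x y
    using common[OF that] add UI by metis
  have zeroU: "0 \<in> U" using zero[of 1] UI[of 1] by simp
  have "directed_system {1::nat..} (\<lambda>k. additive_monoid (G k)) (\<lambda>k l x. x)"
    unfolding directed_system_def
  proof (intro conjI ballI impI allI)
    fix i j :: nat assume "i \<in> {1..}" "j \<in> {1..}"
    then show "\<exists>k\<in>{1..}. i \<le> k \<and> j \<le> k" by (intro bexI[of _ "max i j"]) auto
  next
    fix i :: nat assume "i \<in> {1..}"
    then show "monoid (additive_monoid (G i))"
      by (intro monoid_additive_monoid) (auto simp: zero add)
  next
    fix i j :: nat assume "i \<in> {1..}" "j \<in> {1..}" "i \<le> j"
    then show "(\<lambda>x. x) \<in> monoid_hom (additive_monoid (G i)) (additive_monoid (G j))"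
      using chain[of i j] by (auto simp: monoid_hom_def additive_monoid_def intro!: homI)
  qed auto
  moreover have "cocone {1::nat..} (\<lambda>k. additive_monoid (G k)) (\<lambda>k l x. x)
      (additive_monoid U) (\<lambda>k x. x)"
    unfolding cocone_def
  proof (intro conjI ballI impI)
    show "monoid (additive_monoid U)"
      using zeroU addU by (rule monoid_additive_monoid)
  next
    fix i :: nat assume "i \<in> {1..}"
    then show "(\<lambda>x. x) \<in> monoid_hom (additive_monoid (G i)) (additive_monoid U)"
      using UI by (auto simp: monoid_hom_def additive_monoid_def intro!: homI)
  qed auto
  moreover have "\<exists>h \<in> monoid_hom (additive_monoid U) N.
      (\<forall>i\<in>{1..}. \<forall>x\<in>carrier (additive_monoid (G i)). h x = f i x) \<and>
      (\<forall>h' \<in> monoid_hom (additive_monoid U) N.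
        (\<forall>i\<in>{1..}. \<forall>x\<in>carrier (additive_monoid (G i)). h' x = f i x) \<longrightarrow>
        (\<forall>y\<in>carrier (additive_monoid U). h' y = h y))"
    if "cocone {1::nat..} (\<lambda>k. additive_monoid (G k)) (\<lambda>k l x. x) N f" for N :: "'c monoid" and f
  proof -
    have hom: "f i \<in> monoid_hom (additive_monoid (G i)) N" if "i \<ge> 1" for i
      using \<open>cocone _ _ _ N f\<close> that by (auto simp: cocone_def)
    have compat: "f j x = f i x" if "1 \<le> i" "i \<le> j" "x \<in> G i" for i j x
    proof -
      have "\<forall>i\<in>{1..}. \<forall>j\<in>{1..}. i \<le> j \<longrightarrow>
          (\<forall>x\<in>carrier (additive_monoid (G i)). f j x = f i x)"
        using \<open>cocone _ _ _ N f\<close> unfolding cocone_def by (elim conjE)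
      moreover have "i \<in> {1..}" "j \<in> {1..}" "x \<in> carrier (additive_monoid (G i))"
        using that by (auto simp: additive_monoid_def)
      ultimately show ?thesis using \<open>i \<le> j\<close> by meson
    qed
    \<comment> \<open>The stage is chosen arbitrarily; \<open>compat\<close>, applied to the maximum
      of two stages, makes the value independent of it.\<close>
    define h where "h = (\<lambda>x. f (SOME i. i \<ge> 1 \<and> x \<in> G i) x)"
    have h: "h x = f i x" if ix: "i \<ge> 1" "x \<in> G i" for i x
    proof -
      define j where "j = (SOME i. i \<ge> 1 \<and> x \<in> G i)"
      have "j \<ge> 1 \<and> x \<in> G j" unfolding j_def using ix by (rule someI[of _ i, OF conjI])
      then have "f j x = f (max i j) x" "f i x = f (max i j) x"
        using compat ix by (metis max.cobounded1 max.cobounded2)+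
      then show ?thesis by (simp add: h_def j_def)
    qed
    have "h \<in> monoid_hom (additive_monoid U) N"
      unfolding monoid_hom_def
    proof (intro CollectI conjI homI)
      fix x assume "x \<in> carrier (additive_monoid U)"
      then obtain i where "i \<ge> 1" "x \<in> G i" by (auto simp: U additive_monoid_def)
      then show "h x \<in> carrier N"
        using hom[of i] h by (auto simp: monoid_hom_def hom_def additive_monoid_def)
    next
      fix x y assume "x \<in> carrier (additive_monoid U)" "y \<in> carrier (additive_monoid U)"
      then obtain i where i: "i \<ge> 1" "x \<in> G i" "y \<in> G i"
        using common by (auto simp: additive_monoid_def)
      then show "h (x \<otimes>\<^bsub>additive_monoid U\<^esub> y) = h x \<otimes>\<^bsub>N\<^esub> h y"
        using hom[of i] h add[of i x y]
        by (auto simp: monoid_hom_def hom_def additive_monoid_def)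
    next
      show "h \<one>\<^bsub>additive_monoid U\<^esub> = \<one>\<^bsub>N\<^esub>"
        using hom[of 1] h[of 1 0] zero[of 1] by (auto simp: monoid_hom_def additive_monoid_def)
    qed
    moreover have "h' y = h y"
      if "\<forall>i\<in>{1..}. \<forall>x\<in>carrier (additive_monoid (G i)). h' x = f i x"
        "y \<in> carrier (additive_monoid U)" for h' y
      using that h by (auto simp: U additive_monoid_def)
    ultimately show ?thesis
      using h by (intro bexI[of _ h]) (auto simp: additive_monoid_def)
  qed
  ultimately show ?thesis by (simp add: is_inductive_limit_def)
qed

section \<open>Partial sums and lex-minimal extensions\<close>

definition psum :: "(nat \<Rightarrow> nat) \<Rightarrow> nat \<Rightarrow> nat" where
  "psum e n = (\<Sum>i<n. e i)"

lemma psum_0 [simp]: "psum e 0 = 0"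
  by (simp add: psum_def)

lemma psum_Suc: "psum e (Suc n) = psum e n + e n"
  by (simp add: psum_def)

lemma psum_zero [simp]: "psum 0 n = 0"
  by (simp add: psum_def zero_fun_def)

lemma psum_add: "psum (e + f) n = psum e n + psum f n"
  by (simp add: psum_def sum.distrib)

lemma psum_cong: "(\<And>i. i < n \<Longrightarrow> e i = f i) \<Longrightarrow> psum e n = psum f n"
  by (simp add: psum_def)

lemma psum_eq_imp_eq: "(\<And>n. psum e n = psum f n) \<Longrightarrow> e = f"
  by (metis add_left_imp_eq ext psum_Suc)

text \<open>The last \<open>b\<close> of the first \<open>a + b\<close> entries sum to
  \<open>psum e (a + b) - psum e a\<close>; so with \<open>k = b\<close> and
  \<open>n = a + b\<close> the inequality between blocks is superadditivity.\<close>

lemma binomid_index_iff: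
  "binomid_index m e \<longleftrightarrow>
    (\<forall>a b. enat (a + b) \<le> m \<longrightarrow> psum e a + psum e b \<le> psum e (a + b))"
proof -
  have split: "psum e (a + b) = psum e a + sum e {a..<a + b}" for a b
    unfolding psum_def lessThan_atLeast0 by (simp add: sum.atLeastLessThan_concat)
  show ?thesis
  proof
    assume *: "binomid_index m e"
    show "\<forall>a b. enat (a + b) \<le> m \<longrightarrow> psum e a + psum e b \<le> psum e (a + b)"
    proof (intro allI impI)
      fix a b assume ab: "enat (a + b) \<le> m"
      show "psum e a + psum e b \<le> psum e (a + b)"
      proof (cases "b = 0")
        case False
        then have "sum e {..<b} \<le> sum e {a + b - b..<a + b}"
          using * ab unfolding binomid_index_def by (metis le_add2 less_one not_less)
        then show ?thesis unfolding split by (simp add: psum_def)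
      qed simp
    qed
  next
    assume *: "\<forall>a b. enat (a + b) \<le> m \<longrightarrow> psum e a + psum e b \<le> psum e (a + b)"
    show "binomid_index m e"
      unfolding binomid_index_def
    proof (intro allI impI)
      fix k n assume kn: "1 \<le> k \<and> k \<le> n \<and> enat n \<le> m"
      then have n: "n - k + k = n" by simp
      have "psum e (n - k) + psum e k \<le> psum e (n - k + k)"
        using * kn n by metis
      then show "sum e {..<k} \<le> sum e {n - k..<n}"
        unfolding split using n by (simp add: psum_def)
    qed
  qed
qed

lemma inf_binomid_iff: "e \<in> inf_binomid \<longleftrightarrow> (\<forall>a b. psum e a + psum e b \<le> psum e (a + b))"
  by (simp add: inf_binomid_def binomid_index_iff)

lemma inf_binomidD: "e \<in> inf_binomid \<Longrightarrow> psum e a + psum e b \<le> psum e (a + b)"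
  by (simp add: inf_binomid_iff)

lemma zero_in_inf_binomid [simp]: "0 \<in> inf_binomid"
  by (simp add: inf_binomid_iff)

lemma inf_binomid_add: "e \<in> inf_binomid \<Longrightarrow> f \<in> inf_binomid \<Longrightarrow> e + f \<in> inf_binomid"
  unfolding inf_binomid_iff psum_add
proof (intro allI)
  fix a b
  assume "\<forall>a b. psum e a + psum e b \<le> psum e (a + b)" "\<forall>a b. psum f a + psum f b \<le> psum f (a + b)"
  then have "psum e a + psum e b \<le> psum e (a + b)" "psum f a + psum f b \<le> psum f (a + b)"
    by blast+
  then show "psum e a + psum f a + (psum e b + psum f b) \<le> psum e (a + b) + psum f (a + b)"
    by linarith
qed

text \<open>For a superadditive \<open>psum e\<close> this says that every value beyond
  \<open>k\<close> is the least one that the earlier values permit. By \<open>L_image_eq\<close> it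
  singles out the lex-minimal extensions.\<close>

definition splits_after :: "nat \<Rightarrow> (nat \<Rightarrow> nat) \<Rightarrow> bool" where
  "splits_after k e \<longleftrightarrow> (\<forall>n>k. \<exists>a. 0 < a \<and> a < n \<and> psum e n = psum e a + psum e (n - a))"

lemma splits_after_mono: "splits_after k e \<Longrightarrow> k \<le> l \<Longrightarrow> splits_after l e"
  by (simp add: splits_after_def)

text \<open>The least superadditive continuation of the partial sums of \<open>\<eta>\<close>.\<close>

function greedy_psum :: "nat list \<Rightarrow> nat \<Rightarrow> nat" where
  "greedy_psum \<eta> n =
    (if n \<le> length \<eta> then psum ((!) \<eta>) n
     else Max ((\<lambda>a. greedy_psum \<eta> a + greedy_psum \<eta> (n - a)) ` {0<..<n}))"
  by auto
text \<open>The open range \<open>{0<..<n}\<close> makes both \<open>a\<close> and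
  \<open>n - a\<close> smaller than \<open>n\<close>.\<close>

termination by (relation "measure snd") auto

declare greedy_psum.simps [simp del]

lemma greedy_psum_le: "n \<le> length \<eta> \<Longrightarrow> greedy_psum \<eta> n = psum ((!) \<eta>) n"
  by (subst greedy_psum.simps) simp

lemma greedy_psum_gt:
  "length \<eta> < n \<Longrightarrow>
    greedy_psum \<eta> n = Max ((\<lambda>a. greedy_psum \<eta> a + greedy_psum \<eta> (n - a)) ` {0<..<n})"
  by (subst greedy_psum.simps) simp

text \<open>Up to the length this is the hypothesis on \<open>\<eta>\<close>; beyond it, the
  splitting into \<open>a\<close> and \<open>b\<close> is one of those over which the maximum is
  taken.\<close>

lemma greedy_psum_superadd:
  assumes "\<eta> \<in> fin_binomid k"
  shows "greedy_psum \<eta> a + greedy_psum \<eta> b \<le> greedy_psum \<eta> (a + b)"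
proof -
  have k: "length \<eta> = k" and bin: "binomid_index (enat k) ((!) \<eta>)"
    using assms by (auto simp: fin_binomid_def)
  have zero: "greedy_psum \<eta> 0 = 0" by (simp add: greedy_psum_le)
  consider "a = 0" | "b = 0" | "a + b \<le> k" | "0 < a" "0 < b" "k < a + b" by linarith
  then show ?thesis
  proof cases
    case 3
    then show ?thesis using bin by (simp add: greedy_psum_le k binomid_index_iff)
  next
    case 4
    have "greedy_psum \<eta> a + greedy_psum \<eta> (a + b - a)
        \<le> Max ((\<lambda>i. greedy_psum \<eta> i + greedy_psum \<eta> (a + b - i)) ` {0<..<a + b})"
      using 4 by (intro Max_ge image_eqI[of _ _ a]) auto
    then show ?thesis using 4 k by (simp add: greedy_psum_gt)
  qed (simp_all add: zero)
qed

lemma exists_splitting_extension: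
  assumes "\<eta> \<in> fin_binomid k" "1 \<le> k"
  obtains e where "e \<in> extensions \<eta>" "splits_after k e"
proof
  have k: "length \<eta> = k" using assms by (auto simp: fin_binomid_def)
  let ?T = "greedy_psum \<eta>"
  \<comment> \<open>The truncated difference is exact, since superadditivity makes \<open>?T\<close>
    monotone.\<close>
  define e where "e = (\<lambda>n. ?T (Suc n) - ?T n)"
  have "?T n \<le> ?T (Suc n)" for n
    using greedy_psum_superadd[OF assms(1), of n 1] by simp
  then have T: "psum e n = ?T n" for n
    by (induction n) (simp_all add: psum_Suc e_def greedy_psum_le)
  have "e i = \<eta> ! i" if "i < length \<eta>" for i
    using that by (simp add: e_def greedy_psum_le psum_Suc)
  moreover have "e \<in> inf_binomid"
    using greedy_psum_superadd[OF assms(1)] by (simp add: inf_binomid_iff T)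
  ultimately show "e \<in> extensions \<eta>" by (simp add: extensions_def)
  show "splits_after k e"
    unfolding splits_after_def T
  proof (intro allI impI)
    fix n assume n: "n > k"
    let ?X = "(\<lambda>a. ?T a + ?T (n - a)) ` {0<..<n}"
    \<comment> \<open>This is where \<open>1 \<le> k\<close> matters: it gives
      \<open>n \<ge> 2\<close>, so that a proper splitting exists.\<close>
    have "1 \<in> {0<..<n}" using n assms(2) by simp
    then have "?X \<noteq> {}" by blast
    then have "Max ?X \<in> ?X" by (intro Max_in) auto
    then show "\<exists>a. 0 < a \<and> a < n \<and> ?T n = ?T a + ?T (n - a)"
      using n k by (auto simp: greedy_psum_gt)
  qed
qed

text \<open>Let \<open>m\<close> be the first place of difference. \<open>psum e (Suc m)\<close>
  splits into earlier partial sums, which \<open>f\<close> shares, so superadditivity of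
  \<open>f\<close> makes it a lower bound for \<open>psum f (Suc m)\<close>.\<close>

lemma splitting_extension_lex_less:
  assumes e: "e \<in> extensions \<eta>" "splits_after (length \<eta>) e" and f: "f \<in> extensions \<eta>" "f \<noteq> e"
  shows "less_fun e f"
proof -
  obtain m where m: "f m \<noteq> e m" "\<And>i. i < m \<Longrightarrow> f i = e i"
    using f(2) exists_least_iff[of "\<lambda>m. f m \<noteq> e m"] by auto
  have "m \<ge> length \<eta>" using m(1) e f by (force simp: extensions_def)
  then obtain a where a: "0 < a" "a < Suc m" "psum e (Suc m) = psum e a + psum e (Suc m - a)"
    using e(2) unfolding splits_after_def by (meson le_imp_less_Suc)
  have same: "psum f n = psum e n" if "n \<le> m" for n
    using that m(2) by (intro psum_cong) auto
  have "psum f a + psum f (Suc m - a) \<le> psum f (a + (Suc m - a))"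
    using f(1) by (intro inf_binomidD) (simp add: extensions_def)
  then have "psum e (Suc m) \<le> psum f (Suc m)" using a same by simp
  then have "e m < f m" using m(1) same[of m] by (simp add: psum_Suc)
  then show ?thesis using m(2) by (auto simp: less_fun_def)
qed

lemma lex_min_ext_eqI:
  assumes "e \<in> extensions \<eta>" "splits_after (length \<eta>) e"
  shows "lex_min_ext \<eta> = e"
  unfolding lex_min_ext_def
proof (rule the_equality)
  show "e \<in> extensions \<eta> \<and> (\<forall>f\<in>extensions \<eta>. f \<noteq> e \<longrightarrow> less_fun e f)"
    by (intro conjI ballI impI assms(1) splitting_extension_lex_less[OF assms])
next
  fix f assume f: "f \<in> extensions \<eta> \<and> (\<forall>g\<in>extensions \<eta>. g \<noteq> f \<longrightarrow> less_fun f g)"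
  show "f = e"
  proof (rule ccontr)
    assume "f \<noteq> e"
    then have "less_fun f e" "less_fun e f"
      using f assms(1) splitting_extension_lex_less[OF assms, of f] by auto
    then show False using less_fun_asym by blast
  qed
qed

text \<open>A preimage of a splitting \<open>e\<close> is its initial segment of length
  \<open>k\<close>. This replaces lexicographic minimality by a condition on partial sums.\<close>

lemma L_image_eq:
  assumes "1 \<le> k"
  shows "L_image k = {e \<in> inf_binomid. splits_after k e}"
proof (intro equalityI subsetI)
  fix e assume "e \<in> L_image k"
  then obtain \<eta> where \<eta>: "\<eta> \<in> fin_binomid k" "e = lex_min_ext \<eta>" by (auto simp: L_image_def)
  obtain f where f: "f \<in> extensions \<eta>" "splits_after k f"
    by (rule exists_splitting_extension[OF \<eta>(1) assms])
  then have "e = f" using \<eta> lex_min_ext_eqI[of f \<eta>] by (simp add: fin_binomid_def)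
  then show "e \<in> {e \<in> inf_binomid. splits_after k e}" using f by (simp add: extensions_def)
next
  fix e assume e: "e \<in> {e \<in> inf_binomid. splits_after k e}"
  let ?\<eta> = "map e [0..<k]"
  have ps: "psum ((!) ?\<eta>) n = psum e n" if "n \<le> k" for n
    using that by (intro psum_cong) auto
  have "psum ((!) ?\<eta>) a + psum ((!) ?\<eta>) b \<le> psum ((!) ?\<eta>) (a + b)" if "a + b \<le> k" for a b
    using that ps e inf_binomidD[of e a b] by simp
  then have "?\<eta> \<in> fin_binomid k" by (simp add: fin_binomid_def binomid_index_iff)
  moreover have "lex_min_ext ?\<eta> = e"
    by (rule lex_min_ext_eqI) (use e in \<open>auto simp: extensions_def\<close>)
  ultimately show "e \<in> L_image k" unfolding L_image_def by (metis image_eqI)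
qed

lemma L_image_mono: "1 \<le> k \<Longrightarrow> k \<le> l \<Longrightarrow> L_image k \<subseteq> L_image l"
  by (auto simp: L_image_eq splits_after_mono)

lemma lex_min_seqs_eq: "lex_min_seqs = (\<Union>k\<in>{1..}. L_image k)"
  by (auto simp: lex_min_seqs_def L_image_def)


section \<open>Eventual periodicity\<close>

text \<open>Choose \<open>p\<close> with the greatest ratio among lengths up to \<open>k\<close>.
  Longer lengths split, and a bound on the ratios of both parts is a bound for the whole. Ratios are
  stated by cross multiplication.\<close>

lemma exists_best_ratio:
  assumes e: "splits_after k e" and "1 \<le> k"
  obtains p where "1 \<le> p" "p \<le> k" "\<And>n. psum e n * p \<le> psum e p * n"
proof -
  define r where "r = (\<lambda>j. real (psum e j) / real j)"
  have "Max (r ` {1..k}) \<in> r ` {1..k}" using assms(2) by (intro Max_in) auto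
  then obtain p where p: "p \<in> {1..k}" "r p = Max (r ` {1..k})" by auto
  have "psum e n * p \<le> psum e p * n" for n
  proof (induction n rule: less_induct)
    case (less n)
    consider "n = 0" | "n \<in> {1..k}" | "n > k" by fastforce
    then show ?case
    proof cases
      case 2
      then have "r n \<le> r p" unfolding p(2) by (intro Max_ge) auto
      then have "real (psum e n) * real p \<le> real (psum e p) * real n"
        using 2 p(1) by (simp add: r_def field_simps)
      then show ?thesis by (simp flip: of_nat_mult)
    next
      case 3
      then obtain a where a: "0 < a" "a < n" "psum e n = psum e a + psum e (n - a)"
        using e by (auto simp: splits_after_def)
      have "psum e n * p \<le> psum e p * a + psum e p * (n - a)"
        unfolding a(3) add_mult_distrib using a less.IH by (intro add_mono) auto
      also have "\<dots> = psum e p * n" using a by (simp flip: add_mult_distrib2)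
      finally show ?thesis .
    qed simp
  qed
  then show ?thesis using p(1) by (intro that[of p]) auto
qed

text \<open>Splitting is repeated until every part is at most \<open>k\<close>; no value is lost on
  the way.\<close>

lemma exists_optimal_partition:
  assumes "splits_after k e"
  shows "\<exists>xs. sum_list xs = n \<and> (\<forall>x\<in>set xs. 0 < x \<and> x \<le> k) \<and> psum e n = sum_list (map (psum e) xs)"
proof (induction n rule: less_induct)
  case (less n)
  consider "n = 0" | "0 < n" "n \<le> k" | "n > k" by linarith
  then show ?case
  proof cases
    case 1
    then show ?thesis by (intro exI[of _ "[]"]) simp
  next
    case 2
    then show ?thesis by (intro exI[of _ "[n]"]) simp
  next
    case 3
    then obtain a where a: "0 < a" "a < n" "psum e n = psum e a + psum e (n - a)"
      using assms by (auto simp: splits_after_def)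
    obtain xs ys where
      "sum_list xs = a" "\<forall>x\<in>set xs. 0 < x \<and> x \<le> k" "psum e a = sum_list (map (psum e) xs)"
      "sum_list ys = n - a" "\<forall>x\<in>set ys. 0 < x \<and> x \<le> k" "psum e (n - a) = sum_list (map (psum e) ys)"
      using less.IH[of a] less.IH[of "n - a"] a by auto
    then show ?thesis using a by (intro exI[of _ "xs @ ys"]) auto
  qed
qed

lemma psum_sum_list_le:
  assumes "e \<in> inf_binomid"
  shows "sum_list (map (psum e) xs) \<le> psum e (sum_list xs)"
proof (induction xs)
  case (Cons x xs)
  then show ?case using inf_binomidD[OF assms, of x "sum_list xs"] by simp
qed simp

lemma psum_mult_le:
  assumes "e \<in> inf_binomid"
  shows "q * psum e p \<le> psum e (q * p)"
proof (induction q)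
  case (Suc q)
  then show ?case using inf_binomidD[OF assms, of p "q * p"] by simp
qed simp

text \<open>Pigeonhole: two of the \<open>p + 1\<close> prefix sums agree modulo \<open>p\<close>,
  and the segment between them is the one sought.\<close>

lemma exists_segment_dvd:
  fixes xs :: "nat list"
  assumes "0 < p" "p \<le> length xs"
  obtains us vs ws where "xs = us @ vs @ ws" "vs \<noteq> []" "p dvd sum_list vs"
proof -
  let ?f = "\<lambda>i. sum_list (take i xs) mod p"
  have "?f ` {..p} \<subseteq> {..<p}" using assms(1) by auto
  then have "card (?f ` {..p}) \<le> card {..<p}" by (intro card_mono) auto
  then have "\<not> inj_on ?f {..p}" by (intro pigeonhole) simp
  then obtain i j where ij: "i < j" "j \<le> p" "?f i = ?f j"
    unfolding inj_on_def by (metis atMost_iff linorder_neqE_nat)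
  define vs where "vs = drop i (take j xs)"
  have "take j xs = take i (take j xs) @ vs" unfolding vs_def by (rule append_take_drop_id[symmetric])
  also have "take i (take j xs) = take i xs" using ij by (simp add: min_def)
  finally have tj: "take j xs = take i xs @ vs" .
  have "p dvd sum_list vs"
  proof -
    have "sum_list (take j xs) = sum_list (take i xs) + sum_list vs" unfolding tj by simp
    moreover have "p dvd sum_list (take j xs) - sum_list (take i xs)"
      using ij(3) by (metis calculation le_add1 mod_eq_dvd_iff_nat)
    ultimately show ?thesis by simp
  qed
  moreover have "vs \<noteq> []" using ij assms by (simp add: vs_def)
  moreover have "xs = take i xs @ vs @ drop j xs"
    using append_take_drop_id[of j xs] unfolding tj by simp
  ultimately show ?thesis using that by blast
qed

text \<open>Among \<open>k\<close> parts of an optimal partition some consecutive ones have a sum divisible by \<open>p\<close>.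
  They can be replaced by copies of the part \<open>p\<close> of best ratio, so one copy of \<open>p\<close> splits off.\<close>

lemma psum_add_best_ratio:
  assumes e: "e \<in> inf_binomid" "splits_after k e" and p: "1 \<le> p" "p \<le> k"
    and best: "\<And>n. psum e n * p \<le> psum e p * n" and n: "k * k \<le> n"
  shows "psum e (n + p) = psum e n + psum e p"
proof (rule antisym)
  show "psum e n + psum e p \<le> psum e (n + p)" by (rule inf_binomidD[OF e(1)])
  obtain xs where xs: "sum_list xs = n + p" "\<forall>x\<in>set xs. 0 < x \<and> x \<le> k"
    "psum e (n + p) = sum_list (map (psum e) xs)"
    using exists_optimal_partition[OF e(2)] by blast
  \<comment> \<open>Parts are at most \<open>k\<close>, so a total of at least \<open>k * k\<close>
    needs at least \<open>k\<close>, hence \<open>p\<close>, parts.\<close>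
  have "sum_list zs \<le> length zs * k" if "\<forall>x\<in>set zs. 0 < x \<and> x \<le> k" for zs
    using that by (induction zs) auto
  then have "k * k \<le> length xs * k" using xs(1,2) n by (metis le_add1 order_trans)
  then have "p \<le> length xs" using p by simp
  then obtain us vs ws where seg: "xs = us @ vs @ ws" "vs \<noteq> []" "p dvd sum_list vs"
    using p exists_segment_dvd[of p xs] by auto
  have "sum_list vs \<noteq> 0" using seg(1,2) xs(2) by (cases vs) auto
  \<comment> \<open>The segment has a positive sum, whence \<open>Suc q\<close>: one copy of
    \<open>p\<close> splits off and \<open>q\<close> copies stay with the rest.\<close>
  then obtain q where q: "sum_list vs = p * Suc q"
    using seg(3) by (metis dvdE mult_0_right not0_implies_Suc)
  define m where "m = sum_list (us @ ws)"
  have m: "m + q * p = n" using xs(1) seg(1) q by (simp add: m_def algebra_simps)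
  have "psum e (sum_list vs) * p \<le> (Suc q * psum e p) * p"
    using best[of "sum_list vs"] by (simp only: q mult_ac)
  then have vs: "psum e (sum_list vs) \<le> Suc q * psum e p" using p by simp
  have "psum e (n + p) = sum_list (map (psum e) (us @ ws)) + sum_list (map (psum e) vs)"
    by (simp add: xs(3) seg(1))
  also have "\<dots> \<le> psum e m + Suc q * psum e p"
    unfolding m_def
    by (intro add_mono psum_sum_list_le e(1) order_trans[OF psum_sum_list_le[OF e(1)] vs])
  also have "\<dots> \<le> psum e m + psum e (q * p) + psum e p"
    using psum_mult_le[OF e(1), of q p] by simp
  also have "\<dots> \<le> psum e n + psum e p"
    using inf_binomidD[OF e(1), of m "q * p"] m by simp
  finally show "psum e (n + p) \<le> psum e n + psum e p" .
qed

text \<open>From \<open>N\<close> on, \<open>e\<close> has period \<open>P\<close>, and each period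
  contributes \<open>psum e P\<close>. With \<open>N\<close> and \<open>P\<close> fixed, the
  equations are linear in \<open>e\<close>, so they survive addition.\<close>

definition psum_periodic :: "nat \<Rightarrow> nat \<Rightarrow> (nat \<Rightarrow> nat) \<Rightarrow> bool" where
  "psum_periodic N P e \<longleftrightarrow> (\<forall>n\<ge>N. psum e (n + P) = psum e n + psum e P)"

lemma psum_periodic_zero: "psum_periodic N P 0"
  by (simp add: psum_periodic_def)

lemma psum_periodic_add:
  "psum_periodic N P e \<Longrightarrow> psum_periodic N P f \<Longrightarrow> psum_periodic N P (e + f)"
  by (simp add: psum_periodic_def psum_add)

text \<open>The best \<open>p\<close> depends on \<open>e\<close>, but always divides
  \<open>fact k\<close>. The ratio bound and superadditivity together give
  \<open>psum e (q * p) = q * psum e p\<close>.\<close>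

lemma splits_after_imp_psum_periodic:
  assumes e: "e \<in> inf_binomid" "splits_after k e" and k: "1 \<le> k"
  shows "psum_periodic (k * k) (fact k) e"
proof -
  obtain p where p: "1 \<le> p" "p \<le> k" "\<And>n. psum e n * p \<le> psum e p * n"
    using exists_best_ratio[OF e(2) k] by blast
  then obtain q where q: "(fact k :: nat) = p * q" by (meson dvd_fact dvdE)
  have step: "psum e (n + j * p) = psum e n + j * psum e p" if "n \<ge> k * k" for n j
  proof (induction j)
    case (Suc j)
    have "psum e (n + j * p + p) = psum e (n + j * p) + psum e p"
      using e p that by (intro psum_add_best_ratio) auto
    then show ?case using Suc by (simp add: algebra_simps)
  qed simp
  have "psum e (q * p) * p \<le> (q * psum e p) * p"
    using p(3)[of "q * p"] by (simp only: mult_ac)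
  then have "psum e (q * p) = q * psum e p"
    using psum_mult_le[OF e(1), of q p] p(1) by simp
  then show ?thesis
    using step[of _ q] by (simp add: psum_periodic_def q mult.commute)
qed

lemma psum_periodic_imp_splits_after:
  assumes "psum_periodic N P e" "1 \<le> P"
  shows "splits_after (N + P) e"
  unfolding splits_after_def
proof (intro allI impI)
  fix n assume n: "n > N + P"
  then have "psum e (n - P + P) = psum e (n - P) + psum e P"
    using assms(1) unfolding psum_periodic_def by (metis add_le_imp_le_diff less_imp_le_nat)
  then have "psum e n = psum e P + psum e (n - P)" "P < n" using n by auto
  then show "\<exists>a. 0 < a \<and> a < n \<and> psum e n = psum e a + psum e (n - a)"
    using assms(2) by (intro exI[of _ P]) auto
qed

lemma gen_L_image_periodic:
  assumes "1 \<le> k"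
  shows "gen_submonoid (L_image k) \<subseteq> {e \<in> inf_binomid. psum_periodic (k * k) (fact k) e}"
proof (rule gen_submonoid_least)
  show "L_image k \<subseteq> {e \<in> inf_binomid. psum_periodic (k * k) (fact k) e}"
    unfolding L_image_eq[OF assms] using splits_after_imp_psum_periodic assms by blast
qed (simp_all add: psum_periodic_zero inf_binomid_add psum_periodic_add)

text \<open>All sums share one threshold and one period, and periodicity lets each \<open>n\<close>
  beyond their sum split off a part \<open>fact k\<close>. So sums stay lex-minimal, for a longer
  initial segment.\<close>

lemma gen_L_image_subset:
  assumes "1 \<le> k"
  shows "gen_submonoid (L_image k) \<subseteq> L_image (k * k + fact k)"
proof -
  have "1 \<le> k * k + fact k" by (rule trans_le_add2[OF fact_ge_1])
  then show ?thesis
    using gen_L_image_periodic[OF assms] psum_periodic_imp_splits_after[OF _ fact_ge_1]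
    unfolding L_image_eq[OF \<open>1 \<le> k * k + fact k\<close>] by blast
qed

lemma lex_min_seqs_eq_union: "lex_min_seqs = (\<Union>k\<in>{1..}. gen_submonoid (L_image k))"
proof
  show "lex_min_seqs \<subseteq> (\<Union>k\<in>{1..}. gen_submonoid (L_image k))"
    using gen_submonoid_superset unfolding lex_min_seqs_eq by (rule UN_mono[OF subset_refl])
  show "(\<Union>k\<in>{1..}. gen_submonoid (L_image k)) \<subseteq> lex_min_seqs"
  proof (rule UN_least)
    fix k :: nat assume "k \<in> {1..}"
    then have "gen_submonoid (L_image k) \<subseteq> L_image (k * k + fact k)"
      by (intro gen_L_image_subset) simp
    moreover have "k * k + fact k \<in> {1..}" using trans_le_add2[OF fact_ge_1] by simp
    ultimately show "gen_submonoid (L_image k) \<subseteq> lex_min_seqs"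
      unfolding lex_min_seqs_eq by blast
  qed
qed


section \<open>Atoms\<close>

text \<open>The defect of superadditivity. For binomid indices the subtraction is exact, and a
  pointwise difference is again a binomid index when its excess is nonnegative.\<close>

definition excess :: "(nat \<Rightarrow> nat) \<Rightarrow> nat \<Rightarrow> nat \<Rightarrow> nat" where
  "excess e a b = psum e (a + b) - (psum e a + psum e b)"

lemma psum_eq_excess:
  "e \<in> inf_binomid \<Longrightarrow> psum e (a + b) = psum e a + psum e b + excess e a b"
  using inf_binomidD[of e a b] by (simp add: excess_def)

lemma excess_commute: "excess e a b = excess e b a"
  by (simp add: excess_def add.commute)

text \<open>Lowering an argument by \<open>P\<close> changes no excess as long as it is at least
  \<open>N + P\<close>: the increment \<open>psum g P\<close> cancels. So a finite square of
  arguments decides.\<close>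

lemma excess_le_of_small:
  assumes e: "psum_periodic N P e" and f: "psum_periodic N P f" and P: "1 \<le> P"
    and small: "\<And>a b. a < N + P \<Longrightarrow> b < N + P \<Longrightarrow> excess e a b \<le> excess f a b"
  shows "excess e a b \<le> excess f a b"
proof -
  have shift: "excess g a b = excess g (a - P) b" if "psum_periodic N P g" "a \<ge> N + P" for g a b
  proof -
    have "N \<le> a - P" "N \<le> a - P + b" using that(2) by auto
    then have "psum g (a - P + P) = psum g (a - P) + psum g P"
      "psum g (a - P + b + P) = psum g (a - P + b) + psum g P"
      using that(1) unfolding psum_periodic_def by blast+
    moreover have "a - P + P = a" "a - P + b + P = a + b" using that by auto
    ultimately show ?thesis by (simp add: excess_def)
  qed
  show ?thesis
  proof (induction "a + b" arbitrary: a b rule: less_induct)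
    case less
    consider "a \<ge> N + P" | "b \<ge> N + P" | "a < N + P" "b < N + P" by linarith
    then show ?case
    proof cases
      case 1
      then have "a - P + b < a + b" using P by linarith
      from less.hyps[OF this] show ?thesis using shift[of _ a b] 1 e f by simp
    next
      case 2
      then have "a + (b - P) < a + b" using P by linarith
      from less.hyps[OF this] show ?thesis
        using shift[of _ b a] 2 e f by (simp add: excess_commute[of _ a])
    qed (rule small)
  qed
qed

lemma inf_binomid_diff:
  assumes e: "e \<in> inf_binomid" and f: "f \<in> inf_binomid"
    and start: "e 0 \<le> f 0" and le: "\<And>a b. excess e a b \<le> excess f a b"
  obtains g where "g \<in> inf_binomid" "f = e + g"
proof -
  \<comment> \<open>Each entry is the first one plus an excess; hence \<open>start\<close> and
    \<open>le\<close> suffice for comparing entries.\<close>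
  have val: "h n = h 0 + excess h n 1" if "h \<in> inf_binomid" for h n
    using psum_eq_excess[OF that, of n 1] by (simp add: psum_Suc)
  have pointwise: "e n \<le> f n" for n
    using val[OF e, of n] val[OF f, of n] start le[of n 1] by linarith
  define g where "g = (\<lambda>n. f n - e n)"
  have fg: "f = e + g" using pointwise by (auto simp: g_def fun_eq_iff)
  have "psum g a + psum g b \<le> psum g (a + b)" for a b
    using psum_eq_excess[OF e, of a b] psum_eq_excess[OF f, of a b] le[of a b]
    unfolding fg psum_add by linarith
  then have "g \<in> inf_binomid" by (simp add: inf_binomid_iff)
  then show ?thesis using fg by (rule that)
qed

text \<open>With infinitely many atoms, Dickson's lemma would yield distinct atoms \<open>e\<close>
  and \<open>f\<close> such that \<open>f - e\<close> is a nonzero binomid index, so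
  \<open>f\<close> would decompose.\<close>

lemma finite_periodic_atoms:
  assumes "1 \<le> P"
  shows "finite {e \<in> Atom. psum_periodic N P e}"
proof (rule ccontr)
  assume inf: "infinite {e \<in> Atom. psum_periodic N P e}"
  \<comment> \<open>These coordinates are the data from which \<open>inf_binomid_diff\<close>
    permits subtraction, cut down to the finite square.\<close>
  define v where "v = (\<lambda>e i. case i of None \<Rightarrow> e 0 | Some (a, b) \<Rightarrow> excess e a b)"
  define I where "I = insert None (Some ` ({..<N + P} \<times> {..<N + P}))"
  have "finite I" by (simp add: I_def)
  with inf obtain e f where ef: "e \<in> {e \<in> Atom. psum_periodic N P e}"
    "f \<in> {e \<in> Atom. psum_periodic N P e}" "e \<noteq> f" "\<forall>i\<in>I. v e i \<le> v f i"
    by (rule dickson)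
  have per: "psum_periodic N P e" "psum_periodic N P f" and atoms: "e \<in> Atom" "f \<in> Atom"
    using ef(1,2) by simp_all
  have small: "excess e a b \<le> excess f a b" if "a < N + P" "b < N + P" for a b
    using bspec[OF ef(4), of "Some (a, b)"] that by (simp add: I_def v_def)
  have le: "excess e a b \<le> excess f a b" for a b
    by (rule excess_le_of_small[OF per assms small])
  have "e 0 \<le> f 0" using bspec[OF ef(4), of None] by (simp add: I_def v_def)
  moreover have bin: "e \<in> inf_binomid" "f \<in> inf_binomid" using atoms by (simp_all add: Atom_def)
  ultimately obtain g where g: "g \<in> inf_binomid" "f = e + g"
    using inf_binomid_diff[OF bin _ le] by metis
  moreover have "g \<noteq> 0" using ef(3) g(2) by auto
  ultimately show False using atoms bin unfolding Atom_def by blast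
qed

lemma finite_Atom_L_image: "1 \<le> k \<Longrightarrow> finite (Atom \<inter> L_image k)"
  by (rule finite_subset[OF _ finite_periodic_atoms[of "fact k" "k * k"]])
    (auto simp: L_image_eq splits_after_imp_psum_periodic)

text \<open>A value of a sum of superadditive functions can only split additively if the values of both
  summands do.\<close>

lemma splits_after_summand:
  assumes "e \<in> inf_binomid" "f \<in> inf_binomid" "splits_after k (e + f)"
  shows "splits_after k e"
  unfolding splits_after_def
proof (intro allI impI)
  fix n assume "n > k"
  then obtain a where a: "0 < a" "a < n"
    "psum e n + psum f n = psum e a + psum f a + (psum e (n - a) + psum f (n - a))"
    using assms(3) unfolding splits_after_def psum_add by blast
  have "psum e a + psum e (n - a) \<le> psum e n" "psum f a + psum f (n - a) \<le> psum f n"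
    using a inf_binomidD[OF assms(1), of a "n - a"] inf_binomidD[OF assms(2), of a "n - a"]
    by simp_all
  then show "\<exists>a. 0 < a \<and> a < n \<and> psum e n = psum e a + psum e (n - a)"
    using a by (intro exI[of _ a]) linarith
qed

text \<open>Monotonicity kills the values up to \<open>k\<close>, splitting those beyond. Hence
  every nonzero summand contributes to the \<open>k\<close>-th partial sum.\<close>

lemma splits_after_eq_zero:
  assumes "e \<in> inf_binomid" "splits_after k e" "psum e k = 0"
  shows "e = 0"
proof (rule psum_eq_imp_eq)
  have "psum e n = 0" for n
  proof (induction n rule: less_induct)
    case (less n)
    show ?case
    proof (cases "n \<le> k")
      case True
      then show ?thesis
        using inf_binomidD[OF assms(1), of n "k - n"] assms(3) by simp
    next
      case False
      then obtain a where "0 < a" "a < n" "psum e n = psum e a + psum e (n - a)"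
        using assms(2) unfolding splits_after_def by (meson not_le)
      then show ?thesis using less.IH by simp
    qed
  qed
  then show "psum e n = psum 0 n" for n by (simp only: psum_zero)
qed

text \<open>Descent on \<open>psum e k\<close>: both summands of a decomposition inherit the
  splitting, and since neither is zero, both have a smaller \<open>k\<close>-th partial sum.\<close>

lemma L_image_subset_gen_Atom:
  assumes "1 \<le> k" "e \<in> L_image k"
  shows "e \<in> gen_submonoid (Atom \<inter> L_image k)"
  using assms(2)
proof (induction "psum e k" arbitrary: e rule: less_induct)
  case less
  have e: "e \<in> inf_binomid" "splits_after k e" using less.prems assms(1) by (auto simp: L_image_eq)
  consider "e = 0" | "e \<in> Atom" | "e \<noteq> 0" "e \<notin> Atom" by blast
  then show ?case
  proof cases
    case 1
    then show ?thesis by simp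
  next
    case 2
    then show ?thesis using less.prems gen_submonoid_superset by blast
  next
    case 3
    then obtain f g where fg: "f \<in> inf_binomid" "g \<in> inf_binomid" "f \<noteq> 0" "g \<noteq> 0" "e = f + g"
      using e(1) unfolding Atom_def by blast
    have f: "splits_after k f" and g: "splits_after k g"
      using splits_after_summand[of f g k] splits_after_summand[of g f k] e(2) fg
      by (simp_all add: add.commute)
    have "psum f k \<noteq> 0" "psum g k \<noteq> 0" using splits_after_eq_zero f g fg by blast+
    then have "psum f k < psum e k" "psum g k < psum e k" by (simp_all add: fg(5) psum_add)
    then have "f \<in> gen_submonoid (Atom \<inter> L_image k)" "g \<in> gen_submonoid (Atom \<inter> L_image k)"
      using less.hyps f g fg assms(1) by (auto simp: L_image_eq)
    then show ?thesis unfolding fg(5) by (rule gen_submonoid_add)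
  qed
qed

lemma gen_Atom_L_image:
  assumes "1 \<le> k"
  shows "gen_submonoid (Atom \<inter> L_image k) = gen_submonoid (L_image k)"
proof
  show "gen_submonoid (Atom \<inter> L_image k) \<subseteq> gen_submonoid (L_image k)"
    using gen_submonoid_superset by (intro gen_submonoid_least gen_submonoid_add) auto
  show "gen_submonoid (L_image k) \<subseteq> gen_submonoid (Atom \<inter> L_image k)"
    using L_image_subset_gen_Atom[OF assms] by (intro gen_submonoid_least gen_submonoid_add) auto
qed

theorem theorem4p13:
  shows "is_inductive_limit TYPE('c) {1::nat..}
           (\<lambda>k. additive_monoid (gen_submonoid (L_image k))) (\<lambda>k l x. x)
           (additive_monoid lex_min_seqs) (\<lambda>k x. x) \<and>
         (\<forall>k\<ge>1. finitely_presented_monoid (additive_monoid (gen_submonoid (L_image k)))) \<and>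
         (\<forall>k l. 1 \<le> k \<and> k \<le> l \<longrightarrow> Atom \<inter> L_image k \<subseteq> Atom \<inter> L_image l) \<and>
         (\<forall>k\<ge>1. gen_submonoid (Atom \<inter> L_image k) = gen_submonoid (L_image k))"
proof (intro conjI allI impI)
  have "gen_submonoid (L_image k) \<subseteq> gen_submonoid (L_image l)" if "1 \<le> k" "k \<le> l" for k l
    using L_image_mono[OF that] gen_submonoid_superset
    by (intro gen_submonoid_least gen_submonoid_add) auto
  then show "is_inductive_limit TYPE('c) {1::nat..}
      (\<lambda>k. additive_monoid (gen_submonoid (L_image k))) (\<lambda>k l x. x)
      (additive_monoid lex_min_seqs) (\<lambda>k x. x)"
    by (intro inductive_limit_chain_union lex_min_seqs_eq_union zero_in_gen_submonoid
        gen_submonoid_add)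
next
  fix k :: nat assume k: "k \<ge> 1"
  show "gen_submonoid (Atom \<inter> L_image k) = gen_submonoid (L_image k)"
    using k by (rule gen_Atom_L_image)
  \<comment> \<open>By this equality finitely many atoms generate the submonoid.\<close>
  then show "finitely_presented_monoid (additive_monoid (gen_submonoid (L_image k)))"
    using finitely_presented_gen_submonoid[OF finite_Atom_L_image[OF k]] by simp
next
  fix k l :: nat assume "1 \<le> k \<and> k \<le> l"
  then show "Atom \<inter> L_image k \<subseteq> Atom \<inter> L_image l" using L_image_mono by blast
qed

end
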